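(* Let $1\le r<\infty$, $1\le p<r'$ and $\frac{p}{r'}<\gamma<1$, where $\frac1r+\frac1{r'}=1$ (with $r'=\infty$ and $\frac p{r'}=0$ if $r=1$). Let $A$ be a Young function for which there exists $c_A>0$ such that $$A^{-1}(t)\simeq\frac{t^{1/r}}{\varphi(t)}\qquad\text{for }t>c_A,$$ where $\varphi$ is a positive function such that for every $s\in(0,1)$ there exist $c_s>0$ and $\kappa_s>0$ with $0<\varphi(t)<\kappa_st^s$ for every $t>c_s$. Then there exists an operator $T$ on $\mathbb{R}^n$ satisfying an $A$-Hörmander condition such that $$\|T\|_{L^p(w)\to L^{p,\infty}(w)}=\infty,\qquad\text{where }w(x)=|x|^{-\gamma n}.$$
   Context: Cubes $Q\subset\mathbb{R}^n$ have sides parallel to the axes, $l(Q)$ is the side length, $cQ$ is the concentric dilate. A Young function is a continuous, convex, increasing $A:[0,\infty)\to[0,\infty)$ with $A(0)=0$; $\|f\|_{A,Q}=\inf\{\lambda>0:\frac1{|Q|}\int_QA(|f|/\lambda)\le1\}$; $A^{-1}$ is the inverse function. $F\simeq G$ means that $F/G$ is bounded above and below by positive constants. An operator $T$ satisfies an $A$-Hörmander condition if it is linear, bounded on $L^2(\mathbb{R}^n)$, admits the representation $Tf(x)=\int K(x,y)f(y)\,dy$ for $f\in\mathcal{C}_c^\infty$ and $x\notin\operatorname{supp}f$ with a kernel $K$ locally integrable away from the diagonal, and $\max\{H_{K,A,1},H_{K,A,2}\}<\infty$, where $$H_{K,A,1}=\sup_Q\sup_{x,z\in\frac12Q}\sum_{k=1}^\infty(2^kl(Q))^n\|(K(x,\cdot)-K(z,\cdot))\chi_{2^kQ\setminus2^{k-1}Q}\|_{A,2^kQ}$$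 and $H_{K,A,2}$ is the same with $K(\cdot,x)-K(\cdot,z)$. $\|g\|_{L^{p,\infty}(w)}=\sup_{\lambda>0}\lambda\,w(\{x:|g(x)|>\lambda\})^{1/p}$, $w(E)=\int_Ew$. *)

theory Defs
  imports "HOL-Analysis.Analysis"
begin

text \<open>
  A Young function is encoded as a function on the reals of which only the restriction to
  \<open>{0..}\<close> matters.  Monotonicity is not required to be strict.  If a Young function \<open>A\<close> does not
  vanish identically, then by convexity every \<open>t > 0\<close> has exactly one preimage in \<open>{0..}\<close>, so
  \<open>inv_into {0..} A t\<close> is the value of the inverse function at \<open>t\<close>.
\<close>

definition young_function :: "(real \<Rightarrow> real) \<Rightarrow> bool" where
  "young_function A \<longleftrightarrow>
     continuous_on {0..} A \<and> convex_on {0..} A \<and> mono_on {0..} A \<and> A 0 = 0"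

definition young_inverse :: "(real \<Rightarrow> real) \<Rightarrow> real \<Rightarrow> real" where
  "young_inverse A = inv_into {0..} A"

definition comparable_on :: "'a set \<Rightarrow> ('a \<Rightarrow> real) \<Rightarrow> ('a \<Rightarrow> real) \<Rightarrow> bool" where
  "comparable_on S F G \<longleftrightarrow> (\<exists>a>0. \<exists>b>0. \<forall>t\<in>S. a \<le> F t / G t \<and> F t / G t \<le> b)"

text \<open>The infimum of the empty set is \<open>\<infinity>\<close>.\<close>

definition luxemburg_norm ::
    "(real \<Rightarrow> real) \<Rightarrow> 'a::euclidean_space set \<Rightarrow> ('a \<Rightarrow> complex) \<Rightarrow> ennreal" where
  "luxemburg_norm A Q f =
     Inf {ennreal c |c. c > 0 \<and>
       (\<integral>\<^sup>+x\<in>Q. ennreal (A (norm (f x) / c)) \<partial>lborel) / emeasure lborel Q \<le> 1}"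

text \<open>Used only for exponents \<open>s > 0\<close>.\<close>

definition ennreal_powr :: "ennreal \<Rightarrow> real \<Rightarrow> ennreal" where
  "ennreal_powr x s = (if x = \<infinity> then \<infinity> else ennreal (enn2real x powr s))"

definition Lp_norm :: "real \<Rightarrow> ('a::euclidean_space \<Rightarrow> real) \<Rightarrow> ('a \<Rightarrow> complex) \<Rightarrow> ennreal" where
  "Lp_norm p w f =
     ennreal_powr (\<integral>\<^sup>+x. ennreal (norm (f x) powr p * w x) \<partial>lborel) (1 / p)"

definition Lp_space :: "real \<Rightarrow> ('a::euclidean_space \<Rightarrow> real) \<Rightarrow> ('a \<Rightarrow> complex) set" where
  "Lp_space p w = {f \<in> borel_measurable lborel. Lp_norm p w f < \<infinity>}"

abbreviation L2_norm :: "('a::euclidean_space \<Rightarrow> complex) \<Rightarrow> ennreal" where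
  "L2_norm \<equiv> Lp_norm 2 (\<lambda>_. 1)"

abbreviation L2_space :: "('a::euclidean_space \<Rightarrow> complex) set" where
  "L2_space \<equiv> Lp_space 2 (\<lambda>_. 1)"

definition weighted_measure :: "('a::euclidean_space \<Rightarrow> real) \<Rightarrow> 'a set \<Rightarrow> ennreal" where
  "weighted_measure w E = (\<integral>\<^sup>+x\<in>E. ennreal (w x) \<partial>lborel)"

definition weak_Lp_norm ::
    "real \<Rightarrow> ('a::euclidean_space \<Rightarrow> real) \<Rightarrow> ('a \<Rightarrow> complex) \<Rightarrow> ennreal" where
  "weak_Lp_norm p w g =
     (SUP t\<in>{0<..}. ennreal t * ennreal_powr (weighted_measure w {x. norm (g x) > t}) (1 / p))"

text \<open>
  Operators act on functions (representatives) and are only constrained on \<open>L\<^sup>2\<close>.  The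
  supremum defining the norm from \<open>L\<^sup>p(w)\<close> to \<open>L\<^bsup>p,\<infinity>\<^esup>(w)\<close> is accordingly taken over the functions of
  \<open>L\<^sup>p(w)\<close> on which an operator bounded on \<open>L\<^sup>2\<close> is defined; any extension to a larger part of
  \<open>L\<^sup>p(w)\<close> has at least this norm.
\<close>

definition weak_type_norm ::
    "(('a::euclidean_space \<Rightarrow> complex) \<Rightarrow> ('a \<Rightarrow> complex)) \<Rightarrow> real \<Rightarrow> ('a \<Rightarrow> real) \<Rightarrow> ennreal" where
  "weak_type_norm T p w =
     (SUP f\<in>{f \<in> L2_space \<inter> Lp_space p w. Lp_norm p w f \<noteq> 0}.
        weak_Lp_norm p w (T f) / Lp_norm p w f)"

primrec Ck_function :: "nat \<Rightarrow> ('a::euclidean_space \<Rightarrow> 'b::real_normed_vector) \<Rightarrow> bool" where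
  "Ck_function 0 f \<longleftrightarrow> continuous_on UNIV f"
| "Ck_function (Suc k) f \<longleftrightarrow> f differentiable_on UNIV \<and>
     (\<forall>b\<in>Basis. Ck_function k (\<lambda>x. frechet_derivative f (at x) b))"

definition supp :: "('a::topological_space \<Rightarrow> 'b::zero) \<Rightarrow> 'a set" where
  "supp f = closure {x. f x \<noteq> 0}"

definition test_functions :: "('a::euclidean_space \<Rightarrow> complex) set" where
  "test_functions = {f. (\<forall>k. Ck_function k f) \<and> compact (supp f)}"

text \<open>
  The closed cube with centre \<open>c\<close> and side length \<open>l\<close>; its concentric dilate by \<open>s\<close> is
  \<open>cube c (s * l)\<close>.
\<close>

definition cube :: "'a::euclidean_space \<Rightarrow> real \<Rightarrow> 'a set" where
  "cube c l = cbox (c - (l / 2) *\<^sub>R One) (c + (l / 2) *\<^sub>R One)"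

text \<open>
  The sum over \<open>k \<ge> 1\<close> is written as a sum over all naturals, with \<open>Suc k\<close> in place of \<open>k\<close>.
\<close>

definition hormander_const ::
    "('a::euclidean_space \<Rightarrow> 'a \<Rightarrow> complex) \<Rightarrow> (real \<Rightarrow> real) \<Rightarrow> ennreal" where
  "hormander_const K A =
     (SUP (c, l) \<in> UNIV \<times> {0<..}. SUP (x, z) \<in> cube c (l / 2) \<times> cube c (l / 2).
        \<Sum>k. ennreal ((2 ^ Suc k * l) ^ DIM('a)) *
          luxemburg_norm A (cube c (2 ^ Suc k * l))
            (\<lambda>y. (K x y - K z y) * indicator (cube c (2 ^ Suc k * l) - cube c (2 ^ k * l)) y))"

definition H1 :: "('a::euclidean_space \<Rightarrow> 'a \<Rightarrow> complex) \<Rightarrow> (real \<Rightarrow> real) \<Rightarrow> ennreal" where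
  "H1 K A = hormander_const K A"

definition H2 :: "('a::euclidean_space \<Rightarrow> 'a \<Rightarrow> complex) \<Rightarrow> (real \<Rightarrow> real) \<Rightarrow> ennreal" where
  "H2 K A = hormander_const (\<lambda>x y. K y x) A"

text \<open>
  Integrability is with respect to \<open>lborel\<close>, so kernels are Borel measurable off the diagonal; in
  particular all the sections occurring in \<^const>\<open>hormander_const\<close> are Borel measurable there.
\<close>

definition locally_integrable_off_diagonal ::
    "('a::euclidean_space \<Rightarrow> 'a \<Rightarrow> complex) \<Rightarrow> bool" where
  "locally_integrable_off_diagonal K \<longleftrightarrow>
     (\<forall>C. compact C \<and> (\<forall>x. (x, x) \<notin> C) \<longrightarrow> set_integrable lborel C (\<lambda>(x, y). K x y))"

definition linear_on_L2 :: "(('a::euclidean_space \<Rightarrow> complex) \<Rightarrow> ('a \<Rightarrow> complex)) \<Rightarrow> bool" where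
  "linear_on_L2 T \<longleftrightarrow>
     (\<forall>f\<in>L2_space. \<forall>g\<in>L2_space. \<forall>a b.
        AE x in lborel. T (\<lambda>y. a * f y + b * g y) x = a * T f x + b * T g x)"

text \<open>
  Together with linearity this implies that \<open>T\<close> respects almost everywhere equality on \<open>L\<^sup>2\<close>.
\<close>

definition bounded_on_L2 :: "(('a::euclidean_space \<Rightarrow> complex) \<Rightarrow> ('a \<Rightarrow> complex)) \<Rightarrow> bool" where
  "bounded_on_L2 T \<longleftrightarrow>
     (\<exists>C::real. \<forall>f\<in>L2_space. T f \<in> L2_space \<and> L2_norm (T f) \<le> ennreal C * L2_norm f)"

definition represented_by ::
    "(('a::euclidean_space \<Rightarrow> complex) \<Rightarrow> ('a \<Rightarrow> complex)) \<Rightarrow> ('a \<Rightarrow> 'a \<Rightarrow> complex) \<Rightarrow> bool" where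
  "represented_by T K \<longleftrightarrow>
     (\<forall>f\<in>test_functions. \<forall>x. x \<notin> supp f \<longrightarrow>
        has_bochner_integral lborel (\<lambda>y. K x y * f y) (T f x))"

definition hormander_operator ::
    "(real \<Rightarrow> real) \<Rightarrow> (('a::euclidean_space \<Rightarrow> complex) \<Rightarrow> ('a \<Rightarrow> complex)) \<Rightarrow> bool" where
  "hormander_operator A T \<longleftrightarrow>
     linear_on_L2 T \<and> bounded_on_L2 T \<and>
     (\<exists>K. locally_integrable_off_diagonal K \<and> represented_by T K \<and>
          max (H1 K A) (H2 K A) < \<infinity>)"

end

theory Submission
  imports Defs
begin

text \<open>
  The operator is convolution with \<open>k(u) = |u - e|\<^bsup>-n\<theta>\<^esup>\<close> cut off to \<open>|u - e| < 1/2\<close>, where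
  \<open>e = (1, \<dots>, 1)\<close> and \<open>1 - \<gamma>/p < \<theta> < 1/r\<close>; such \<open>\<theta>\<close> exist because \<open>\<gamma> > p/r'\<close>.  Since \<open>k\<close> is integrable,
  the operator is bounded on \<open>L\<^sup>2\<close>.  The hypothesis on \<open>A\<^sup>-\<^sup>1\<close> gives \<open>A(t) \<le> C (1 + t\<^sup>q)\<close> for some
  \<open>q\<close> with \<open>\<theta>q < 1\<close>, so \<open>k\<close> has finite \<open>L\<^sup>q\<close> norm, and this already yields the Hoermander condition
  because \<open>k\<close> lives at distance comparable to 1 from the origin.

  The weight is of size 1 near \<open>-e\<close>, but singular at 0, where the convolution sends what sits near
  \<open>-e\<close>.  Testing on the indicator of \<open>B(-e, \<delta>)\<close>, whose norm is comparable to \<open>\<delta>\<^bsup>n/p\<^esup>\<close>, its image is at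
  least a multiple of \<open>\<delta>\<^bsup>n(1-\<theta>)\<^esup>\<close> on \<open>B(0, \<delta>)\<close>, a ball of weighted measure at least a multiple of
  \<open>\<delta>\<^bsup>n(1-\<gamma>)\<^esup>\<close>.  The quotient of norms is at least a multiple of \<open>\<delta>\<^bsup>n(1-\<theta>-\<gamma>/p)\<^esup>\<close>, which blows up as \<open>\<delta>\<close> tends to 0.
\<close>

section \<open>Young functions and the growth bound obtained from the inverse\<close>

lemma young_function_nonneg:
  assumes "young_function A" "0 \<le> x"
  shows "0 \<le> A x"
proof -
  have "A 0 \<le> A x" using assms unfolding young_function_def by (intro mono_onD[of "{0..}" A]) auto
  then show ?thesis using assms unfolding young_function_def by simp
qed

lemma young_function_scale:
  assumes "young_function A" "0 \<le> s" "s \<le> 1" "0 \<le> x"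
  shows "A (s * x) \<le> s * A x"
  using convex_onD[of "{0..}" A s 0 x] assms unfolding young_function_def by auto

text \<open>For \<open>u < v\<close>, convexity gives \<open>A u \<le> (u / v) * A v\<close>, which
  is strictly below \<open>A v\<close> once \<open>A v\<close> is positive. So two points can share
  a value only where \<open>A\<close> vanishes.\<close>

lemma young_function_inj:
  assumes "young_function A" "0 \<le> x" "0 \<le> y" "A x = A y" "0 < A x"
  shows "x = y"
proof -
  have *: False if "0 \<le> u" "u < v" "A u = A v" "0 < A u" for u v
  proof -
    have "A ((u / v) * v) \<le> (u / v) * A v"
      using that by (intro young_function_scale assms) auto
    also have "\<dots> < 1 * A v" using that by (intro mult_strict_right_mono) auto
    finally show False using that by simp
  qed
  show ?thesis using *[of x y] *[of y x] assms by (metis linorder_neqE_linordered_idom)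
qed

text \<open>A positive value has only one preimage in \<open>{0..}\<close>, so the choice made by
  \<open>inv_into\<close> is forced.\<close>

lemma young_inverse_eq:
  assumes "young_function A" "0 \<le> x" "0 < A x"
  shows "young_inverse A (A x) = x"
proof -
  have "A x \<in> A ` {0..}" using assms by auto
  then have "young_inverse A (A x) \<in> {0..}" "A (young_inverse A (A x)) = A x"
    unfolding young_inverse_def by (rule inv_into_into, rule f_inv_into_f)
  then show ?thesis using young_function_inj assms by (metis atLeast_iff)
qed

text \<open>With \<open>t = A x\<close>, the lower comparison bound and the bound on
  \<open>\<phi>\<close> give \<open>a * t powr (1 / r) \<le> \<kappa> * x * t powr s\<close>.
  Solving for \<open>t\<close> yields a multiple of \<open>x powr q\<close> with
  \<open>q = 1 / (1 / r - s)\<close>.\<close>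

lemma young_function_power_bound:
  assumes A: "young_function A" and r: "1 \<le> r" and s: "0 < s" "s < 1 / r"
    and cA: "0 < cA"
    and comp: "comparable_on {cA<..} (young_inverse A) (\<lambda>t. t powr (1 / r) / \<phi> t)"
    and \<phi>: "\<exists>c>0. \<exists>\<kappa>>0. \<forall>t>c. 0 < \<phi> t \<and> \<phi> t < \<kappa> * t powr s"
  obtains C where "0 < C" "\<And>t. 0 \<le> t \<Longrightarrow> A t \<le> C * (1 + t powr (1 / (1 / r - s)))"
proof -
  define q where "q = 1 / (1 / r - s)"
  have q: "q > 0" "(1 / r - s) * q = 1" using s unfolding q_def by auto
  from comp obtain a where a: "a > 0" "\<And>t. t > cA \<Longrightarrow> a \<le> young_inverse A t / (t powr (1 / r) / \<phi> t)"
    unfolding comparable_on_def by fastforce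
  from \<phi> obtain c \<kappa> where c: "c > 0" "\<kappa> > 0" "\<And>t. t > c \<Longrightarrow> 0 < \<phi> t \<and> \<phi> t < \<kappa> * t powr s"
    by blast
  \<comment> \<open>Both asymptotic hypotheses concern heights above \<open>M\<close>; values of
    \<open>A\<close> up to \<open>M\<close> are absorbed by the constant term of the bound, since
    \<open>M \<le> C\<close>.\<close>
  define M where "M = max cA c"
  define C where "C = max M ((\<kappa> / a) powr q)"
  have M: "M > 0" using cA unfolding M_def by auto
  have C: "C > 0" "M \<le> C" "(\<kappa> / a) powr q \<le> C" using M unfolding C_def by auto
  have "A x \<le> C * (1 + x powr q)" if x: "0 \<le> x" for x
  proof (cases "A x \<le> M")
    case True
    have "C * 1 \<le> C * (1 + x powr q)" using C by (intro mult_left_mono) auto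
    with True C show ?thesis by linarith
  next
    case False
    define t where "t = A x"
    have t: "t > cA" "t > c" "t > 0" using False M unfolding t_def M_def by auto
    have inv: "young_inverse A t = x" using young_inverse_eq[OF A x] t unfolding t_def by simp
    have "a * t powr (1 / r) \<le> x * \<phi> t"
      using a(2)[OF t(1)] c(3)[OF t(2)] t unfolding inv by (simp add: pos_le_divide_eq)
    also have "\<dots> \<le> x * (\<kappa> * t powr s)"
      using c(3)[OF t(2)] x by (intro mult_left_mono) auto
    finally have "t powr (1 / r) / t powr s \<le> (\<kappa> / a) * x"
      using a t by (simp add: field_simps)
    then have "t powr (1 / r - s) \<le> (\<kappa> / a) * x" by (simp add: powr_diff)
    then have "(t powr (1 / r - s)) powr q \<le> ((\<kappa> / a) * x) powr q"
      using q by (intro powr_mono2) auto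
    also have "\<dots> = (\<kappa> / a) powr q * x powr q"
      by (rule powr_mult)
    finally have "t \<le> (\<kappa> / a) powr q * x powr q"
      using q t by (simp add: powr_powr)
    also have "\<dots> \<le> C * x powr q" using C by (intro mult_right_mono) auto
    also have "\<dots> \<le> C * (1 + x powr q)" using C by (intro mult_left_mono) auto
    finally show ?thesis unfolding t_def .
  qed
  with C(1) show ?thesis using that unfolding q_def by blast
qed

section \<open>Powers in \<open>ennreal\<close>, translation and reflection of integrals, power
  singularities\<close>

lemma ennreal_powr_mono:
  assumes "x \<le> y" "0 \<le> s"
  shows "ennreal_powr x s \<le> ennreal_powr y s"
  using assms by (cases x; cases y)
    (auto simp: ennreal_powr_def top_unique intro!: ennreal_leI powr_mono2 ennreal_less_zero_iff)

lemma ennreal_powr_ennreal: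
  assumes "0 \<le> x"
  shows "ennreal_powr (ennreal x) s = ennreal (x powr s)"
  using assms by (simp add: ennreal_powr_def)

lemma ennreal_powr_less_top: "x < top \<Longrightarrow> ennreal_powr x s < top"
  by (simp add: ennreal_powr_def)

lemma emeasure_lborel_ball:
  fixes c :: "'a::euclidean_space"
  assumes "0 \<le> \<rho>"
  shows "emeasure lborel (ball c \<rho>) = ennreal (\<rho> ^ DIM('a) * measure lborel (ball (0::'a) 1))"
  using content_ball_conv_unit_ball[OF assms, of c] emeasure_lborel_ball_finite[of c \<rho>]
  by (simp add: emeasure_eq_ennreal_measure)

lemma nn_integral_lborel_translate:
  fixes f :: "'a::euclidean_space \<Rightarrow> ennreal"
  assumes "f \<in> borel_measurable borel"
  shows "(\<integral>\<^sup>+x. f (x - c) \<partial>lborel) = (\<integral>\<^sup>+x. f x \<partial>lborel)"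
proof -
  have "(\<integral>\<^sup>+x. f x \<partial>lborel) = (\<integral>\<^sup>+x. f x \<partial>distr lborel borel ((+) (- c)))"
    by (simp add: lborel_distr_plus)
  also have "\<dots> = (\<integral>\<^sup>+x. f (x - c) \<partial>lborel)"
    using assms by (subst nn_integral_distr) auto
  finally show ?thesis ..
qed

lemma nn_integral_lborel_reflect:
  fixes f :: "'a::euclidean_space \<Rightarrow> ennreal"
  assumes [measurable]: "f \<in> borel_measurable borel"
  shows "(\<integral>\<^sup>+x. f (c - x) \<partial>lborel) = (\<integral>\<^sup>+x. f x \<partial>lborel)"
proof -
  have "(lborel :: 'a measure) = distr lborel borel (\<lambda>x. c + (- 1) *\<^sub>R x)"
    using lborel_affine[of "-1" c] by (simp add: density_1)
  then have "(\<integral>\<^sup>+x. f x \<partial>lborel) = (\<integral>\<^sup>+x. f x \<partial>distr lborel borel (\<lambda>x. c + (- 1) *\<^sub>R x))"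
    by simp
  also have "\<dots> = (\<integral>\<^sup>+x. f (c - x) \<partial>lborel)"
    by (subst nn_integral_distr) auto
  finally show ?thesis ..
qed

text \<open>Dyadic decomposition: on the shell between radii \<open>(1/2) ^ Suc j\<close> and
  \<open>(1/2) ^ j\<close> the integrand is at most \<open>c j\<close>. Enlarging each shell to the
  full ball of the outer radius leaves a geometric series with ratio
  \<open>2 powr (a - n) < 1\<close>.\<close>

lemma nn_integral_norm_powr_ball_finite:
  fixes a :: real
  assumes a: "0 \<le> a" "a < DIM('a::euclidean_space)"
  shows "(\<integral>\<^sup>+v. ennreal (norm (v::'a) powr (- a)) * indicator (ball 0 1) v \<partial>lborel) < \<infinity>"
proof -
  define n where "n = DIM('a)"
  define V where "V = measure lborel (ball (0::'a) 1)"
  have V: "V \<ge> 0" unfolding V_def by simp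
  define c where "c = (\<lambda>j::nat. ((1/2::real) ^ Suc j) powr (- a))"
  define h where "h = (\<lambda>j (v::'a). ennreal (c j) * indicator (ball 0 ((1/2) ^ j)) v)"
  have le: "ennreal (norm v powr (- a)) * indicator (ball 0 1) v \<le> (\<Sum>j. h j v)" for v :: 'a
  proof (cases "v \<noteq> 0 \<and> norm v < 1")
    case True
    have "\<exists>j. (1/2::real) ^ Suc j \<le> norm v"
    proof -
      obtain m where "(1/2::real) ^ m < norm v" using real_arch_pow_inv[of "norm v" "1/2"] True by auto
      then have "(1/2::real) ^ Suc m \<le> norm v" using norm_ge_zero[of v] by (simp, linarith)
      then show ?thesis by blast
    qed
    \<comment> \<open>Minimality supplies the upper bound \<open>norm v < (1/2) ^ j\<close>; for
      \<open>j = 0\<close> it is the assumption \<open>norm v < 1\<close>.\<close>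
    define j where "j = (LEAST j. (1/2::real) ^ Suc j \<le> norm v)"
    have j1: "(1/2::real) ^ Suc j \<le> norm v" unfolding j_def by (rule LeastI_ex) fact
    have j2: "norm v < (1/2) ^ j"
    proof (cases j)
      case 0 then show ?thesis using True by simp
    next
      case (Suc i)
      then show ?thesis using not_less_Least[of i "\<lambda>j. (1/2::real) ^ Suc j \<le> norm v"]
        unfolding j_def[symmetric] by auto
    qed
    have "norm v powr (- a) \<le> c j" unfolding c_def using j1 a by (intro powr_mono2') auto
    then have "ennreal (norm v powr (- a)) * indicator (ball 0 1) v \<le> h j v"
      using True j2 unfolding h_def by (auto intro: ennreal_leI)
    also have "\<dots> \<le> (\<Sum>j. h j v)" using sum_le_suminf[of "\<lambda>j. h j v" "{j}"] by simp
    finally show ?thesis .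
  next
    case False
    \<comment> \<open>At the origin the integrand is 0 because \<open>0 powr (- a) = 0\<close>;
      outside the unit ball the indicator vanishes.\<close>
    then show ?thesis by (cases "v = 0") auto
  qed
  have "(\<integral>\<^sup>+v. ennreal (norm (v::'a) powr (- a)) * indicator (ball 0 1) v \<partial>lborel)
      \<le> (\<integral>\<^sup>+v. (\<Sum>j. h j v) \<partial>lborel)" by (intro nn_integral_mono le)
  also have "\<dots> = (\<Sum>j. \<integral>\<^sup>+v. h j v \<partial>lborel)"
    unfolding h_def
    by (intro nn_integral_suminf borel_measurable_times_ennreal borel_measurable_const
        borel_measurable_indicator) auto
  also have "\<dots> = (\<Sum>j. ennreal (2 powr a * V * (2 powr (a - n)) ^ j))"
  proof (intro suminf_cong)
    fix j
    have "(\<integral>\<^sup>+v. h j v \<partial>lborel) = ennreal (c j) * emeasure lborel (ball (0::'a) ((1/2) ^ j))"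
      unfolding h_def by (subst nn_integral_cmult) (auto intro!: borel_measurable_indicator)
    also have "\<dots> = ennreal (c j * (((1/2) ^ j) ^ n * V))"
      by (subst emeasure_lborel_ball) (auto simp: ennreal_mult n_def V_def c_def)
    also have "c j * (((1/2) ^ j) ^ n * V) = 2 powr a * V * (2 powr (a - n)) ^ j"
    proof -
      have pw: "(1/2::real) ^ k = 2 powr (- real k)" for k
        by (simp add: powr_minus powr_realpow power_one_over inverse_eq_divide)
      have c: "c j = 2 powr (a * (real j + 1))"
        unfolding c_def pw powr_powr by (simp add: algebra_simps)
      have e1: "((1/2::real) ^ j) ^ n = 2 powr (- (real j * real n))"
        using power_mult[of "1/2::real" j n] pw[of "j * n"] by (simp only: of_nat_mult)
      have e2: "(2 powr (a - n)) ^ j = 2 powr ((a - n) * real j)"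
        by (subst powr_realpow[symmetric]) (simp_all add: powr_powr)
      have e3: "2 powr (a * (real j + 1)) * 2 powr (- (real j * real n))
          = 2 powr a * 2 powr ((a - n) * real j)"
        unfolding powr_add[symmetric] by (simp add: algebra_simps)
      have "c j * (((1/2) ^ j) ^ n * V) = (2 powr (a * (real j + 1)) * 2 powr (- (real j * real n))) * V"
        by (simp only: c e1 mult.assoc)
      also have "\<dots> = 2 powr a * (2 powr ((a - n) * real j) * V)"
        by (simp only: e3 mult.assoc)
      also have "\<dots> = 2 powr a * (V * 2 powr ((a - n) * real j))"
        by (simp only: mult.commute)
      finally show ?thesis by (simp only: e2 mult.assoc)
    qed
    finally show "(\<integral>\<^sup>+v. h j v \<partial>lborel) = ennreal (2 powr a * V * (2 powr (a - n)) ^ j)" .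
  qed
  also have "\<dots> < \<infinity>"
  proof -
    have "2 powr (a - n) < 2 powr 0" using a unfolding n_def by (intro powr_less_mono) auto
    then have "norm (2 powr (a - n)) < 1" by simp
    then have "summable (\<lambda>j. 2 powr a * V * (2 powr (a - n)) ^ j)"
      by (rule summable_mult[OF summable_geometric])
    then have "(\<Sum>j. ennreal (2 powr a * V * (2 powr (a - n)) ^ j)) \<noteq> top"
      by (rule ennreal_suminf_neq_top) (simp add: V)
    then show ?thesis unfolding infinity_ennreal_def by (rule top.not_eq_extremum[THEN iffD1])
  qed
  finally show ?thesis .
qed

section \<open>Convolution with a nonnegative integrable kernel\<close>

text \<open>The integral defaults to 0 where the integrand is not integrable, so the operator is
  total. For the kernels below and \<open>f\<close> in \<open>L2_space\<close> this default occurs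
  only on a null set of points.\<close>

definition conv_op :: "('a::euclidean_space \<Rightarrow> real) \<Rightarrow> ('a \<Rightarrow> complex) \<Rightarrow> 'a \<Rightarrow> complex" where
  "conv_op g f x = (LINT y|lborel. complex_of_real (g (x - y)) * f y)"

text \<open>Replaces the real power by a square in \<open>ennreal\<close>, the form in which
  Cauchy-Schwarz is applied.\<close>

lemma Lp_norm_2: "Lp_norm 2 (\<lambda>_. 1) f = ennreal_powr (\<integral>\<^sup>+x. (ennreal (norm (f x)))\<^sup>2 \<partial>lborel) (1 / 2)"
  by (simp add: Lp_norm_def ennreal_power)

lemma nn_integral_square_L2_space:
  fixes f :: "'a::euclidean_space \<Rightarrow> complex"
  assumes "f \<in> L2_space"
  obtains B where "0 \<le> B" "(\<integral>\<^sup>+x. (ennreal (norm (f x)))\<^sup>2 \<partial>lborel) = ennreal B"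
proof -
  have "(\<integral>\<^sup>+x. (ennreal (norm (f x)))\<^sup>2 \<partial>lborel) \<noteq> \<infinity>"
    using assms unfolding Lp_space_def by (auto simp: Lp_norm_2 ennreal_powr_def)
  then show ?thesis using that by (cases "\<integral>\<^sup>+x. (ennreal (norm (f x)))\<^sup>2 \<partial>lborel") auto
qed

text \<open>These assumptions already yield every clause of \<open>hormander_operator\<close> other
  than the finiteness of \<open>H1\<close> and \<open>H2\<close>.\<close>

locale integrable_kernel =
  fixes g :: "'a::euclidean_space \<Rightarrow> real" and G :: real
  assumes measurable_g [measurable]: "g \<in> borel_measurable borel"
    and g_nonneg: "0 \<le> g x"
    and G_nonneg: "0 \<le> G"
    and nn_integral_g: "(\<integral>\<^sup>+x. ennreal (g x) \<partial>lborel) = ennreal G"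
begin

text \<open>Young's convolution inequality for an integrable and a square integrable factor: split
  the kernel into two factors \<open>sqrt g\<close>, apply Cauchy-Schwarz for fixed
  \<open>x\<close>, and integrate in \<open>x\<close> by Tonelli. Each of the two steps contributes
  one factor \<open>G\<close>.\<close>

lemma square_nn_integral_conv_le:
  assumes [measurable]: "f \<in> borel_measurable lborel"
  shows "(\<integral>\<^sup>+x. (\<integral>\<^sup>+y. ennreal (g (x - y)) * f y \<partial>lborel)\<^sup>2 \<partial>lborel)
    \<le> ennreal (G\<^sup>2) * (\<integral>\<^sup>+y. (f y)\<^sup>2 \<partial>lborel)"
proof -
  have sq: "ennreal (sqrt (g u)) * (ennreal (sqrt (g u)) * z) = ennreal (g u) * z"
    "(ennreal (sqrt (g u)))\<^sup>2 = ennreal (g u)" for u and z :: ennreal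
    using g_nonneg by (simp_all add: mult.assoc[symmetric] ennreal_mult[symmetric] ennreal_power)
  have "(\<integral>\<^sup>+y. ennreal (g (x - y)) * f y \<partial>lborel)\<^sup>2
      \<le> ennreal G * (\<integral>\<^sup>+y. ennreal (g (x - y)) * (f y)\<^sup>2 \<partial>lborel)" for x
  proof -
    have "(\<integral>\<^sup>+y. ennreal (sqrt (g (x - y))) * (ennreal (sqrt (g (x - y))) * f y) \<partial>lborel)\<^sup>2
      \<le> (\<integral>\<^sup>+y. (ennreal (sqrt (g (x - y))))\<^sup>2 \<partial>lborel)
        * (\<integral>\<^sup>+y. (ennreal (sqrt (g (x - y))) * f y)\<^sup>2 \<partial>lborel)"
      by (rule Cauchy_Schwarz_nn_integral) measurable
    then show ?thesis
      using nn_integral_lborel_reflect[of "\<lambda>u. ennreal (g u)" x]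
      by (simp add: sq power_mult_distrib nn_integral_g)
  qed
  then have "(\<integral>\<^sup>+x. (\<integral>\<^sup>+y. ennreal (g (x - y)) * f y \<partial>lborel)\<^sup>2 \<partial>lborel)
      \<le> (\<integral>\<^sup>+x. ennreal G * (\<integral>\<^sup>+y. ennreal (g (x - y)) * (f y)\<^sup>2 \<partial>lborel) \<partial>lborel)"
    by (intro nn_integral_mono)
  also have "\<dots> = ennreal G * (\<integral>\<^sup>+x. (\<integral>\<^sup>+y. ennreal (g (x - y)) * (f y)\<^sup>2 \<partial>lborel) \<partial>lborel)"
    by (intro nn_integral_cmult) measurable
  also have "(\<integral>\<^sup>+x. (\<integral>\<^sup>+y. ennreal (g (x - y)) * (f y)\<^sup>2 \<partial>lborel) \<partial>lborel)
      = (\<integral>\<^sup>+y. (\<integral>\<^sup>+x. ennreal (g (x - y)) * (f y)\<^sup>2 \<partial>lborel) \<partial>lborel)"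
    by (intro lborel_pair.Fubini') measurable
  also have "\<dots> = (\<integral>\<^sup>+y. ennreal G * (f y)\<^sup>2 \<partial>lborel)"
    using nn_integral_lborel_translate[of "\<lambda>u. ennreal (g u)"]
    by (simp add: nn_integral_multc nn_integral_g)
  also have "\<dots> = ennreal G * (\<integral>\<^sup>+y. (f y)\<^sup>2 \<partial>lborel)"
    by (intro nn_integral_cmult) measurable
  finally show ?thesis
    using G_nonneg by (simp add: mult.assoc[symmetric] ennreal_mult[symmetric] power2_eq_square)
qed

text \<open>The convolution of the absolute values has a finite integral of its square, hence is
  finite almost everywhere.\<close>

lemma AE_integrable_conv:
  assumes "f \<in> L2_space"
  shows "AE x in lborel. integrable lborel (\<lambda>y. complex_of_real (g (x - y)) * f y)"
proof -
  have [measurable]: "f \<in> borel_measurable lborel" using assms by (simp add: Lp_space_def)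
  obtain B where "(\<integral>\<^sup>+x. (ennreal (norm (f x)))\<^sup>2 \<partial>lborel) = ennreal B"
    by (rule nn_integral_square_L2_space[OF assms])
  then have "(\<integral>\<^sup>+x. (\<integral>\<^sup>+y. ennreal (g (x - y)) * ennreal (norm (f y)) \<partial>lborel)\<^sup>2 \<partial>lborel) \<noteq> \<infinity>"
    using square_nn_integral_conv_le[of "\<lambda>y. ennreal (norm (f y))"]
    by (auto simp: ennreal_mult_eq_top_iff top_unique)
  then have "AE x in lborel. (\<integral>\<^sup>+y. ennreal (g (x - y)) * ennreal (norm (f y)) \<partial>lborel)\<^sup>2 \<noteq> \<infinity>"
    by (rule nn_integral_noteq_infinite[rotated]) measurable
  then show ?thesis
  proof eventually_elim
    case (elim x)
    then have "(\<integral>\<^sup>+y. ennreal (g (x - y)) * ennreal (norm (f y)) \<partial>lborel) \<noteq> \<infinity>"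
      by (auto simp: power2_eq_square ennreal_mult_eq_top_iff)
    then have "(\<integral>\<^sup>+y. ennreal (norm (complex_of_real (g (x - y)) * f y)) \<partial>lborel) < \<infinity>"
      using g_nonneg by (simp add: norm_mult ennreal_mult' top.not_eq_extremum)
    then show ?case by (intro integrableI_bounded) measurable
  qed
qed

lemma conv_op_L2_bounded:
  assumes "f \<in> L2_space"
  shows "conv_op g f \<in> L2_space" "L2_norm (conv_op g f) \<le> ennreal G * L2_norm f"
proof -
  have [measurable]: "f \<in> borel_measurable lborel" using assms by (simp add: Lp_space_def)
  have meas [measurable]: "conv_op g f \<in> borel_measurable lborel"
    unfolding conv_op_def[abs_def] by measurable
  obtain B where B: "0 \<le> B" "(\<integral>\<^sup>+x. (ennreal (norm (f x)))\<^sup>2 \<partial>lborel) = ennreal B"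
    by (rule nn_integral_square_L2_space[OF assms])
  have le: "ennreal (norm (conv_op g f x))
      \<le> (\<integral>\<^sup>+y. ennreal (g (x - y)) * ennreal (norm (f y)) \<partial>lborel)" for x
  proof (cases "integrable lborel (\<lambda>y. complex_of_real (g (x - y)) * f y)")
    case True
    then have "ennreal (norm (conv_op g f x))
        \<le> (\<integral>\<^sup>+y. ennreal (norm (complex_of_real (g (x - y)) * f y)) \<partial>lborel)"
      unfolding conv_op_def by (rule integral_norm_bound_ennreal)
    then show ?thesis using g_nonneg by (simp add: norm_mult ennreal_mult')
  next
    \<comment> \<open>Here \<open>conv_op g f x\<close> is the default value 0, so the domination
      holds at every point.\<close>
    case False
    then show ?thesis by (simp add: conv_op_def not_integrable_integral_eq)
  qed
  have "(\<integral>\<^sup>+x. (ennreal (norm (conv_op g f x)))\<^sup>2 \<partial>lborel)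
      \<le> (\<integral>\<^sup>+x. (\<integral>\<^sup>+y. ennreal (g (x - y)) * ennreal (norm (f y)) \<partial>lborel)\<^sup>2 \<partial>lborel)"
    by (intro nn_integral_mono power_mono le) simp
  also have "\<dots> \<le> ennreal (G\<^sup>2) * (\<integral>\<^sup>+y. (ennreal (norm (f y)))\<^sup>2 \<partial>lborel)"
    by (rule square_nn_integral_conv_le) measurable
  also have "\<dots> = ennreal (G\<^sup>2 * B)" using B by (simp add: ennreal_mult)
  finally have "L2_norm (conv_op g f) \<le> ennreal_powr (ennreal (G\<^sup>2 * B)) (1 / 2)"
    unfolding Lp_norm_2 by (rule ennreal_powr_mono) simp
  also have "\<dots> = ennreal G * L2_norm f"
    unfolding Lp_norm_2 B(2) using B(1) G_nonneg
    by (subst (1 2) ennreal_powr_ennreal)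
      (auto simp: powr_half_sqrt real_sqrt_mult simp flip: ennreal_mult)
  finally show bound: "L2_norm (conv_op g f) \<le> ennreal G * L2_norm f" .
  also have "\<dots> < \<infinity>" using assms unfolding Lp_space_def by (auto simp: ennreal_mult_less_top)
  finally show "conv_op g f \<in> L2_space" using meas by (simp add: Lp_space_def)
qed

lemma bounded_on_L2_conv_op: "bounded_on_L2 (conv_op g)"
  unfolding bounded_on_L2_def using conv_op_L2_bounded by blast

text \<open>The integral may be split at each point where both convolutions converge, that is,
  almost everywhere.\<close>

lemma linear_on_L2_conv_op: "linear_on_L2 (conv_op g)"
  unfolding linear_on_L2_def
proof (intro ballI allI)
  fix f h :: "'a \<Rightarrow> complex" and a b
  assume "f \<in> L2_space" "h \<in> L2_space"
  from AE_integrable_conv[OF this(1)] AE_integrable_conv[OF this(2)]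
  show "AE x in lborel. conv_op g (\<lambda>y. a * f y + b * h y) x = a * conv_op g f x + b * conv_op g h x"
  proof eventually_elim
    case (elim x)
    have "conv_op g (\<lambda>y. a * f y + b * h y) x =
        (LINT y|lborel. a * (complex_of_real (g (x - y)) * f y) + b * (complex_of_real (g (x - y)) * h y))"
      unfolding conv_op_def by (intro Bochner_Integration.integral_cong) (auto simp: algebra_simps)
    also have "\<dots> = a * conv_op g f x + b * conv_op g h x"
      using elim unfolding conv_op_def by (subst Bochner_Integration.integral_add) auto
    finally show ?case .
  qed
qed

text \<open>A bounded \<open>f\<close> makes the integrand dominated by
  \<open>M * g (x - y)\<close>, so convergence holds at every \<open>x\<close>.
  \<open>represented_by\<close> asks for pointwise rather than almost everywhere validity.\<close>

lemma has_bochner_integral_conv_op: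
  assumes [measurable]: "f \<in> borel_measurable borel" and bound: "\<And>y. norm (f y) \<le> M"
  shows "has_bochner_integral lborel (\<lambda>y. complex_of_real (g (x - y)) * f y) (conv_op g f x)"
proof -
  have "0 \<le> M" using bound[of 0] norm_ge_zero order_trans by blast
  have "(\<integral>\<^sup>+y. ennreal (norm (complex_of_real (g (x - y)) * f y)) \<partial>lborel)
      \<le> (\<integral>\<^sup>+y. ennreal (g (x - y)) * ennreal M \<partial>lborel)"
    using bound g_nonneg
    by (intro nn_integral_mono) (auto simp: norm_mult ennreal_mult' intro!: mult_left_mono ennreal_leI)
  also have "\<dots> = ennreal G * ennreal M"
    using nn_integral_lborel_reflect[of "\<lambda>u. ennreal (g u)" x]
    by (simp add: nn_integral_multc nn_integral_g)
  also have "\<dots> < \<infinity>" by (simp add: ennreal_mult_less_top)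
  finally have "integrable lborel (\<lambda>y. complex_of_real (g (x - y)) * f y)"
    by (intro integrableI_bounded) measurable
  then show ?thesis unfolding conv_op_def by (rule has_bochner_integral_integrable)
qed

lemma represented_by_conv_op: "represented_by (conv_op g) (\<lambda>x y. complex_of_real (g (x - y)))"
  unfolding represented_by_def
proof (intro ballI allI impI)
  fix f :: "'a \<Rightarrow> complex" and x
  assume "f \<in> test_functions"
  then have cont: "continuous_on UNIV f" and comp: "compact (supp f)"
    unfolding test_functions_def by (force dest: spec[of _ 0])+
  have "compact (f ` supp f)"
    using cont comp by (intro compact_continuous_image) (auto intro: continuous_on_subset)
  then obtain M where M: "\<And>z. z \<in> f ` supp f \<Longrightarrow> norm z \<le> M"
    using compact_imp_bounded bounded_iff by metis
  \<comment> \<open>The maximum with 0 covers the points outside the support, where \<open>M\<close>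
    gives no information and \<open>f\<close> is 0.\<close>
  have "norm (f y) \<le> max M 0" for y
    using M[of "f y"] closure_subset[of "{x. f x \<noteq> 0}"] unfolding supp_def
    by (cases "f y = 0") (auto simp: le_max_iff_disj)
  then show "has_bochner_integral lborel (\<lambda>y. complex_of_real (g (x - y)) * f y) (conv_op g f x)"
    using cont by (intro has_bochner_integral_conv_op borel_measurable_continuous_onI)
qed

text \<open>\<open>C\<close> projects to a compact set \<open>X\<close> in the first variable.
  Integrating first in \<open>y\<close> over the whole space bounds the integral over
  \<open>C\<close> by the measure of \<open>X\<close> times \<open>G\<close>.\<close>

lemma locally_integrable_off_diagonal_conv:
  "locally_integrable_off_diagonal (\<lambda>x y. complex_of_real (g (x - y)))"
  unfolding locally_integrable_off_diagonal_def
proof (intro allI impI)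
  fix C :: "('a \<times> 'a) set"
  assume "compact C \<and> (\<forall>x. (x, x) \<notin> C)"
  then have C: "compact C" by simp
  have [measurable]: "C \<in> sets (lborel \<Otimes>\<^sub>M lborel)"
    unfolding lborel_prod using C by (simp add: compact_imp_closed borel_closed)
  define X where "X = fst ` C"
  have "compact X" unfolding X_def using C by (intro compact_continuous_image continuous_intros)
  then have [measurable]: "X \<in> sets borel" and X: "emeasure lborel X < \<infinity>"
    by (simp_all only: compact_imp_closed borel_closed emeasure_bounded_finite[OF compact_imp_bounded])
  have "(\<integral>\<^sup>+z. ennreal (norm (indicat_real C z *\<^sub>R (case z of (x, y) \<Rightarrow> complex_of_real (g (x - y))))) \<partial>lborel)
      \<le> (\<integral>\<^sup>+z. indicator X (fst z) * ennreal (g (fst z - snd z)) \<partial>(lborel \<Otimes>\<^sub>M lborel))"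
    unfolding lborel_prod using g_nonneg
    by (intro nn_integral_mono) (auto simp: X_def rev_image_eqI split: split_indicator)
  also have "\<dots> = (\<integral>\<^sup>+x. \<integral>\<^sup>+y. indicator X x * ennreal (g (x - y)) \<partial>lborel \<partial>lborel)"
    by (subst lborel.nn_integral_fst[symmetric]) auto
  also have "\<dots> = (\<integral>\<^sup>+x. indicator X x * ennreal G \<partial>lborel)"
    using nn_integral_lborel_reflect[of "\<lambda>u. ennreal (g u)"]
    by (simp add: nn_integral_cmult nn_integral_g)
  also have "\<dots> = emeasure lborel X * ennreal G"
    by (simp add: nn_integral_multc)
  also have "\<dots> < \<infinity>" using X by (simp add: ennreal_mult_less_top)
  finally have fin: "(\<integral>\<^sup>+z. ennreal (norm (indicat_real C z *\<^sub>R (case z of (x, y) \<Rightarrow> complex_of_real (g (x - y))))) \<partial>lborel) < \<infinity>" .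
  have "(\<lambda>z. indicat_real C z *\<^sub>R (case z of (x, y) \<Rightarrow> complex_of_real (g (x - y)))) \<in> borel_measurable lborel"
    unfolding lborel_prod[symmetric] by measurable
  with fin show "set_integrable lborel C (\<lambda>(x, y). complex_of_real (g (x - y)))"
    unfolding set_integrable_def by (intro integrableI_bounded)
qed

end

section \<open>Luxemburg norms on cubes and finiteness of the Hoermander constant\<close>

lemma luxemburg_norm_le:
  assumes "0 < c" "0 < emeasure lborel Q"
    and "(\<integral>\<^sup>+x\<in>Q. ennreal (A (norm (f x) / c)) \<partial>lborel) \<le> emeasure lborel Q"
  shows "luxemburg_norm A Q f \<le> ennreal c"
  unfolding luxemburg_norm_def
  using assms by (intro Inf_lower) (auto intro!: divide_le_posI_ennreal)

text \<open>Every \<open>c > 0\<close> is admissible in the infimum. This disposes of the terms of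
  the Hoermander sum on whose annulus the kernel difference vanishes.\<close>

lemma luxemburg_norm_zero:
  assumes "A 0 = 0"
  shows "luxemburg_norm A Q (\<lambda>_. 0) = 0"
proof -
  have "luxemburg_norm A Q (\<lambda>_. 0) \<le> ennreal c" if "c > 0" for c
    unfolding luxemburg_norm_def using assms that by (intro Inf_lower) auto
  then have "luxemburg_norm A Q (\<lambda>_. 0) \<le> 0 + ennreal c" if "c > 0" for c
    using that by simp
  then show ?thesis using ennreal_le_epsilon[of 0 "luxemburg_norm A Q (\<lambda>_. 0)"] by simp
qed

lemma emeasure_cube:
  assumes "0 \<le> l"
  shows "emeasure lborel (cube (c::'a::euclidean_space) l) = ennreal (l ^ DIM('a))"
proof -
  have "c \<bullet> b - l / 2 \<le> c \<bullet> b + l / 2" for b using assms by simp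
  then show ?thesis unfolding cube_def
    by (subst emeasure_lborel_cbox) (auto simp: inner_diff_left inner_add_left)
qed

lemma mem_cube:
  fixes x :: "'a::euclidean_space"
  shows "x \<in> cube c l \<longleftrightarrow> (\<forall>b\<in>Basis. \<bar>(x - c) \<bullet> b\<bar> \<le> l / 2)"
  unfolding cube_def mem_box
proof (intro ball_cong refl)
  fix b :: 'a assume "b \<in> Basis"
  then show "(c - (l / 2) *\<^sub>R One) \<bullet> b \<le> x \<bullet> b \<and> x \<bullet> b \<le> (c + (l / 2) *\<^sub>R One) \<bullet> b
      \<longleftrightarrow> \<bar>(x - c) \<bullet> b\<bar> \<le> l / 2"
    unfolding abs_le_iff by (auto simp add: inner_diff_left inner_add_left)
qed

text \<open>Since \<open>c \<ge> 1\<close>, convexity pulls the division by \<open>c\<close> out of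
  \<open>A\<close>; the bound then decays like \<open>1 / c\<close>, so a large \<open>c\<close>
  pushes the mean over a cube below 1.\<close>

lemma young_norm_diff_le:
  fixes u v :: complex
  assumes A: "young_function A" and C: "0 < C" "\<And>t. 0 \<le> t \<Longrightarrow> A t \<le> C * (1 + t powr q)"
    and q: "0 < q" and c: "1 \<le> c"
  shows "A (norm (u - v) / c) \<le> (C / c) * (1 + 2 powr q * (norm u powr q + norm v powr q))"
proof -
  have "norm (u - v) \<le> 2 * max (norm u) (norm v)"
    using norm_triangle_ineq4[of u v] by linarith
  then have "norm (u - v) powr q \<le> (2 * max (norm u) (norm v)) powr q"
    using q by (intro powr_mono2) auto
  also have "\<dots> = 2 powr q * max (norm u) (norm v) powr q"
    by (rule powr_mult)
  also have "\<dots> \<le> 2 powr q * (norm u powr q + norm v powr q)"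
    by (intro mult_left_mono) (auto simp: max_def)
  finally have *: "norm (u - v) powr q \<le> 2 powr q * (norm u powr q + norm v powr q)" .
  have "A (1 / c * norm (u - v)) \<le> 1 / c * A (norm (u - v))"
    using c by (intro young_function_scale A) auto
  also have "\<dots> \<le> 1 / c * (C * (1 + norm (u - v) powr q))"
    using c C by (intro mult_left_mono) auto
  also have "\<dots> \<le> 1 / c * (C * (1 + 2 powr q * (norm u powr q + norm v powr q)))"
    using c C * by (intro mult_left_mono add_left_mono) auto
  finally show ?thesis by simp
qed

text \<open>
  No regularity of the kernel is needed: if \<open>K\<close> lives at distance comparable to 1 from the
  diagonal, only boundedly many terms of the sum are nonzero, and those cubes have volume
  comparable to 1.
\<close>

lemma hormander_const_finite:
  fixes K :: "'a::euclidean_space \<Rightarrow> 'a \<Rightarrow> complex"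
  assumes A: "young_function A" and C: "0 < C" "\<And>t. 0 \<le> t \<Longrightarrow> A t \<le> C * (1 + t powr q)"
    and q: "0 < q"
    and meas [measurable]: "\<And>x. K x \<in> borel_measurable borel"
    and supp: "\<And>x y b. K x y \<noteq> 0 \<Longrightarrow> b \<in> Basis \<Longrightarrow> 1/2 \<le> \<bar>(x - y) \<bullet> b\<bar> \<and> \<bar>(x - y) \<bullet> b\<bar> \<le> 3/2"
    and M: "0 \<le> M" "\<And>x. (\<integral>\<^sup>+y. ennreal (norm (K x y) powr q) \<partial>lborel) \<le> ennreal M"
  shows "hormander_const K A < \<infinity>"
proof -
  define n where "n = DIM('a)"
  \<comment> \<open>The second entry makes the mean of \<open>A (norm (F k y) / c)\<close> at most 1
    on every relevant cube: these have side \<open>L \<ge> 4/5\<close>, whence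
    \<open>1 \<le> (5/4) ^ n * L ^ n\<close>.\<close>
  define c where "c = max 1 (C + C * 2 powr q * (2 * M) * (5/4) ^ n)"
  have c: "1 \<le> c" "C + C * 2 powr q * (2 * M) * (5/4) ^ n \<le> c" unfolding c_def by auto
  \<comment> \<open>Bound for a single term of the sum: volume at most \<open>12 ^ n\<close>,
    Luxemburg norm at most \<open>c\<close>.\<close>
  define B where "B = 12 ^ n * c"
  have B: "0 \<le> B" using c unfolding B_def by auto
  have bound: "(\<Sum>k. ennreal ((2 ^ Suc k * l) ^ DIM('a)) *
          luxemburg_norm A (cube d (2 ^ Suc k * l))
            (\<lambda>y. (K x y - K z y) * indicator (cube d (2 ^ Suc k * l) - cube d (2 ^ k * l)) y))
        \<le> 4 * ennreal B"
    if l: "0 < l" and xz: "x \<in> cube d (l / 2)" "z \<in> cube d (l / 2)" for d x z l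
  proof -
    define F where "F = (\<lambda>k y. (K x y - K z y) * indicator (cube d (2 ^ Suc k * l) - cube d (2 ^ k * l)) y)"
    define T where "T = (\<lambda>k. ennreal ((2 ^ Suc k * l) ^ DIM('a)) * luxemburg_norm A (cube d (2 ^ Suc k * l)) (F k))"
    \<comment> \<open>The scales that can see the kernel. A point of the annulus differs from
      \<open>d\<close> by more than \<open>2 ^ k * l / 2\<close> in some coordinate and by at most
      \<open>2 ^ k * l\<close> in each, while \<open>w\<close> differs by at most
      \<open>l / 4\<close>. So that coordinate of \<open>w - y\<close> lies between 1/4 and 5/4
      times \<open>2 ^ k * l\<close> in absolute value, and it must meet the interval from 1/2 to
      3/2.\<close>
    define S where "S = {k. 2/5 \<le> 2 ^ k * l \<and> 2 ^ k * l < 6}"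
    have scale: "k \<in> S"
      if w: "w \<in> cube d (l / 2)" and y: "y \<in> cube d (2 ^ Suc k * l)" "y \<notin> cube d (2 ^ k * l)"
        and nz: "K w y \<noteq> 0" for w y k
    proof -
      have l2: "l \<le> 2 ^ k * l" using l by simp
      obtain b where b: "b \<in> Basis" "2 ^ k * l / 2 < \<bar>(y - d) \<bullet> b\<bar>"
        using y(2) unfolding mem_cube by (auto simp: not_le)
      have 1: "\<bar>(w - d) \<bullet> b\<bar> \<le> l / 4" using w b unfolding mem_cube by auto
      have 2: "\<bar>(y - d) \<bullet> b\<bar> \<le> 2 ^ k * l" using y(1) b unfolding mem_cube by auto
      have 3: "(w - y) \<bullet> b = (w - d) \<bullet> b - (y - d) \<bullet> b" by (simp add: inner_diff_left)
      have 4: "1/2 \<le> \<bar>(w - y) \<bullet> b\<bar>" "\<bar>(w - y) \<bullet> b\<bar> \<le> 3/2" using supp[OF nz b(1)] by auto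
      show ?thesis unfolding S_def mem_Collect_eq using l2 1 2 3 4 b(2) l by arith
    qed
    have T0: "T k = 0" if "k \<notin> S" for k
    proof -
      have "F k = (\<lambda>_. 0)"
        using scale[OF xz(1)] scale[OF xz(2)] that unfolding F_def
        by (fastforce split: split_indicator)
      moreover have "A 0 = 0" using A unfolding young_function_def by simp
      ultimately show ?thesis unfolding T_def by (simp add: luxemburg_norm_zero)
    qed
    have TB: "T k \<le> ennreal B" if k: "k \<in> S" for k
    proof -
      define L where "L = 2 ^ Suc k * l"
      have L: "4/5 \<le> L" "L \<le> 12" using k unfolding S_def L_def mem_Collect_eq power_Suc by linarith+
      have vol: "emeasure lborel (cube d L) = ennreal (L ^ n)" using L by (simp add: emeasure_cube n_def)
      have L1: "(4/5) ^ n \<le> L ^ n" "L ^ n \<le> 12 ^ n" using L by (auto intro!: power_mono)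
      have "(\<integral>\<^sup>+y\<in>cube d L. ennreal (A (norm (F k y) / c)) \<partial>lborel)
          \<le> (\<integral>\<^sup>+y. ennreal (C / c) * indicator (cube d L) y
              + ennreal (C / c * 2 powr q) * (ennreal (norm (K x y) powr q) + ennreal (norm (K z y) powr q)) \<partial>lborel)"
      proof (intro nn_integral_mono)
        fix y
        have "A (norm (F k y) / c) \<le> A (norm (K x y - K z y) / c)"
          using young_function_nonneg[OF A, of "norm (K x y - K z y) / c"] c A
          unfolding F_def young_function_def by (auto split: split_indicator)
        also have "\<dots> \<le> (C / c) * (1 + 2 powr q * (norm (K x y) powr q + norm (K z y) powr q))"
          by (rule young_norm_diff_le[OF A C q c(1)])
        also have "\<dots> = C / c + (C / c * 2 powr q) * (norm (K x y) powr q + norm (K z y) powr q)"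
          by (simp add: algebra_simps)
        finally have "ennreal (A (norm (F k y) / c))
            \<le> ennreal (C / c + (C / c * 2 powr q) * (norm (K x y) powr q + norm (K z y) powr q))"
          by (rule ennreal_leI)
        also have "\<dots> = ennreal (C / c)
            + ennreal (C / c * 2 powr q) * (ennreal (norm (K x y) powr q) + ennreal (norm (K z y) powr q))"
          using c C by (simp flip: ennreal_plus ennreal_mult)
        finally show "ennreal (A (norm (F k y) / c)) * indicator (cube d L) y
            \<le> ennreal (C / c) * indicator (cube d L) y
              + ennreal (C / c * 2 powr q) * (ennreal (norm (K x y) powr q) + ennreal (norm (K z y) powr q))"
          by (auto split: split_indicator)
      qed
      also have "\<dots> = ennreal (C / c) * emeasure lborel (cube d L) + ennreal (C / c * 2 powr q) *
          ((\<integral>\<^sup>+y. ennreal (norm (K x y) powr q) \<partial>lborel) + (\<integral>\<^sup>+y. ennreal (norm (K z y) powr q) \<partial>lborel))"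
      proof -
        have [measurable]: "cube d L \<in> sets borel" by (simp add: cube_def)
        show ?thesis by (simp add: nn_integral_add nn_integral_cmult)
      qed
      also have "\<dots> \<le> ennreal (C / c) * ennreal (L ^ n) + ennreal (C / c * 2 powr q) * (ennreal M + ennreal M)"
        unfolding vol by (intro add_left_mono mult_left_mono add_mono M) auto
      also have "\<dots> = ennreal (C / c * L ^ n + C / c * 2 powr q * (2 * M))"
      proof -
        have "ennreal M + ennreal M = ennreal (2 * M)"
          using ennreal_plus[OF M(1) M(1)] by simp
        moreover have "ennreal (C / c) * ennreal (L ^ n) = ennreal (C / c * L ^ n)"
          using c C L by (intro ennreal_mult[symmetric]) auto
        moreover have "ennreal (C / c * 2 powr q) * ennreal (2 * M) = ennreal (C / c * 2 powr q * (2 * M))"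
          using c C M by (intro ennreal_mult[symmetric]) auto
        moreover have "ennreal (C / c * L ^ n) + ennreal (C / c * 2 powr q * (2 * M))
            = ennreal (C / c * L ^ n + C / c * 2 powr q * (2 * M))"
          using c C L M by (intro ennreal_plus[symmetric] mult_nonneg_nonneg) auto
        ultimately show ?thesis by (simp only:)
      qed
      also have "\<dots> \<le> ennreal (L ^ n)"
      proof (intro ennreal_leI)
        define X where "X = C / c * 2 powr q * (2 * M)"
        have X: "0 \<le> X" unfolding X_def using c C M by (intro mult_nonneg_nonneg) auto
        have "1 = (5/4::real) ^ n * (4/5) ^ n" by (simp flip: power_mult_distrib)
        also have "\<dots> \<le> (5/4) ^ n * L ^ n" using L1 by (intro mult_left_mono) auto
        finally have "X * 1 \<le> X * ((5/4) ^ n * L ^ n)" using X by (rule mult_left_mono)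
        then have "C / c * L ^ n + X \<le> (C / c + X * (5/4) ^ n) * L ^ n"
          by (simp only: distrib_right mult.assoc mult_1_right add_left_mono)
        also have "C / c + X * (5/4) ^ n = (C + C * 2 powr q * (2 * M) * (5/4) ^ n) / c"
          unfolding X_def by (simp only: add_divide_distrib times_divide_eq_left)
        also have "(C + C * 2 powr q * (2 * M) * (5/4) ^ n) / c * L ^ n \<le> 1 * L ^ n"
          using c L by (intro mult_right_mono) auto
        finally show "C / c * L ^ n + C / c * 2 powr q * (2 * M) \<le> L ^ n"
          unfolding X_def by simp
      qed
      finally have "luxemburg_norm A (cube d L) (F k) \<le> ennreal c"
        using c L vol by (intro luxemburg_norm_le) auto
      then have "T k \<le> ennreal (L ^ n) * ennreal c"
        unfolding T_def L_def n_def by (intro mult_left_mono) auto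
      also have "\<dots> = ennreal (L ^ n * c)" using c L by (simp add: ennreal_mult)
      also have "\<dots> \<le> ennreal B"
        unfolding B_def using L1 c by (intro ennreal_leI mult_right_mono) auto
      finally show ?thesis .
    qed
    \<comment> \<open>Four doublings already lead out of the range, as
      \<open>2 ^ 4 * (2/5) > 6\<close>.\<close>
    have card: "finite S \<and> card S \<le> 4"
    proof (cases "S = {}")
      case False
      define m where "m = (LEAST k. k \<in> S)"
      have m: "m \<in> S" unfolding m_def using False by (auto intro: LeastI)
      have "S \<subseteq> {m..<m + 4}"
      proof
        fix k assume k: "k \<in> S"
        have "m \<le> k" unfolding m_def by (rule Least_le) fact
        moreover have "k < m + 4"
        proof (rule ccontr)
          assume "\<not> k < m + 4"
          then have "(2::real) ^ (m + 4) * l \<le> 2 ^ k * l" using l by (intro mult_right_mono power_increasing) auto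
          then show False using k m unfolding S_def by (simp add: power_add)
        qed
        ultimately show "k \<in> {m..<m + 4}" by simp
      qed
      then show ?thesis using card_mono[of "{m..<m + 4}" S] by (auto intro: finite_subset)
    qed simp
    have "(\<Sum>k. T k) = (\<Sum>k\<in>S. T k)"
      using card T0 by (intro suminf_finite) auto
    also have "\<dots> \<le> (\<Sum>k\<in>S. ennreal B)" by (intro sum_mono TB)
    also have "\<dots> = of_nat (card S) * ennreal B" by simp
    also have "\<dots> \<le> of_nat 4 * ennreal B"
      using card by (intro mult_right_mono of_nat_mono) auto
    finally show ?thesis unfolding T_def F_def by simp
  qed
  have "hormander_const K A \<le> 4 * ennreal B"
    unfolding hormander_const_def by (intro SUP_least) (auto simp del: power_Suc intro!: SUP_least bound)
  also have "\<dots> < \<infinity>" by (simp add: ennreal_mult_less_top)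
  finally show ?thesis .
qed

section \<open>The power singularity placed at \<open>One\<close>\<close>

text \<open>
  The singularity sits at the vector with all coordinates 1, so that every coordinate stays away
  from 0 on the support.  At the singularity itself the value is 0, because \<open>0 powr (- a) = 0\<close>.
\<close>

definition shifted_power :: "real \<Rightarrow> 'a::euclidean_space \<Rightarrow> real" where
  "shifted_power a u = (if norm (u - One) < 1 / 2 then norm (u - One) powr (- a) else 0)"

lemma shifted_power_nonneg: "0 \<le> shifted_power a u"
  by (simp add: shifted_power_def)

lemma measurable_shifted_power [measurable]: "shifted_power a \<in> borel_measurable borel"
  unfolding shifted_power_def[abs_def] by measurable

lemma shifted_power_support:
  assumes "shifted_power a u \<noteq> 0" "b \<in> Basis"
  shows "1/2 \<le> \<bar>u \<bullet> b\<bar> \<and> \<bar>u \<bullet> b\<bar> \<le> 3/2"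
proof -
  have "norm (u - One) < 1 / 2" using assms(1) by (auto simp: shifted_power_def split: if_splits)
  then have "\<bar>(u - One) \<bullet> b\<bar> < 1 / 2" using Basis_le_norm[OF assms(2), of "u - One"] by linarith
  moreover have "(u - One) \<bullet> b = u \<bullet> b - 1" using assms(2) by (simp add: inner_diff_left)
  ultimately show ?thesis by arith
qed

text \<open>After translation to the origin this is a singularity of order \<open>a * q\<close>
  below the dimension. The case \<open>q = 1\<close> gives integrability of the kernel, the general
  case the input of \<open>hormander_const_finite\<close>.\<close>

lemma nn_integral_shifted_power_finite:
  fixes a q :: real
  assumes "0 \<le> a" "0 < q" "a * q < DIM('a::euclidean_space)"
  shows "(\<integral>\<^sup>+u. ennreal (shifted_power a (u::'a) powr q) \<partial>lborel) < \<infinity>"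
proof -
  have "(\<integral>\<^sup>+u. ennreal (shifted_power a (u::'a) powr q) \<partial>lborel)
      \<le> (\<integral>\<^sup>+u. ennreal (norm (u - One :: 'a) powr (- (a * q))) * indicator (ball 0 1) (u - One) \<partial>lborel)"
    by (intro nn_integral_mono) (auto simp: shifted_power_def powr_powr split: split_indicator)
  also have "\<dots> = (\<integral>\<^sup>+v. ennreal (norm (v::'a) powr (- (a * q))) * indicator (ball 0 1) v \<partial>lborel)"
    by (rule nn_integral_lborel_translate)
      (intro borel_measurable_times_ennreal borel_measurable_indicator; simp)
  also have "\<dots> < \<infinity>"
    using assms by (intro nn_integral_norm_powr_ball_finite) auto
  finally show ?thesis .
qed

lemma integrable_kernel_shifted_power:
  fixes a :: real
  assumes "0 \<le> a" "a < DIM('a::euclidean_space)"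
  obtains G where "integrable_kernel (shifted_power a :: 'a \<Rightarrow> real) G"
proof -
  have "(\<integral>\<^sup>+u. ennreal (shifted_power a (u::'a)) \<partial>lborel) < \<infinity>"
    using nn_integral_shifted_power_finite[of a 1, where 'a='a] assms
    by (simp add: shifted_power_nonneg)
  then obtain G where "0 \<le> G" "(\<integral>\<^sup>+u. ennreal (shifted_power a (u::'a)) \<partial>lborel) = ennreal G"
    by (auto simp: less_top_ennreal)
  then have "integrable_kernel (shifted_power a :: 'a \<Rightarrow> real) G"
    by unfold_locales (auto simp: shifted_power_nonneg)
  then show ?thesis by (rule that)
qed

text \<open>Both sections of the kernel have the same integral of the \<open>q\<close>-th power: for
  \<open>H1\<close> the variable enters by reflection, for \<open>H2\<close> by translation.\<close>

lemma hormander_operator_shifted_power: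
  fixes a q :: real
  assumes A: "young_function A" and C: "0 < C" "\<And>t. 0 \<le> t \<Longrightarrow> A t \<le> C * (1 + t powr q)"
    and a: "0 \<le> a" "a < DIM('a::euclidean_space)" and q: "0 < q" "a * q < DIM('a)"
  shows "hormander_operator A (conv_op (shifted_power a :: 'a \<Rightarrow> real))"
proof -
  obtain G where "integrable_kernel (shifted_power a :: 'a \<Rightarrow> real) G"
    by (rule integrable_kernel_shifted_power[OF a])
  then interpret integrable_kernel "shifted_power a :: 'a \<Rightarrow> real" G .
  define K where "K = (\<lambda>x y :: 'a. complex_of_real (shifted_power a (x - y)))"
  obtain M where M: "0 \<le> M" "(\<integral>\<^sup>+u. ennreal (shifted_power a (u::'a) powr q) \<partial>lborel) = ennreal M"
    using nn_integral_shifted_power_finite[OF a(1) q] by (auto simp: less_top_ennreal)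
  have norm_K: "norm (K x y) = shifted_power a (x - y)" for x y
    by (simp add: K_def shifted_power_nonneg)
  have supp: "1/2 \<le> \<bar>(x - y) \<bullet> b\<bar> \<and> \<bar>(x - y) \<bullet> b\<bar> \<le> 3/2" if "K x y \<noteq> 0" "b \<in> Basis" for x y b
    using that shifted_power_support[of a "x - y" b] by (simp add: K_def)
  have "H1 K A < \<infinity>"
    unfolding H1_def
  proof (rule hormander_const_finite[OF A C q(1)])
    show "K x \<in> borel_measurable borel" for x unfolding K_def by measurable
    show "(\<integral>\<^sup>+y. ennreal (norm (K x y) powr q) \<partial>lborel) \<le> ennreal M" for x
      unfolding norm_K M(2)[symmetric]
      using nn_integral_lborel_reflect[of "\<lambda>u. ennreal (shifted_power a u powr q)" x] by simp
  qed (use supp M in auto)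
  moreover have "H2 K A < \<infinity>"
    unfolding H2_def
  proof (rule hormander_const_finite[OF A C q(1)])
    show "(\<lambda>y. K y x) \<in> borel_measurable borel" for x unfolding K_def by measurable
    show "(\<integral>\<^sup>+y. ennreal (norm (K y x) powr q) \<partial>lborel) \<le> ennreal M" for x
      unfolding norm_K M(2)[symmetric]
      using nn_integral_lborel_translate[of "\<lambda>u. ennreal (shifted_power a u powr q)" x] by simp
    show "1/2 \<le> \<bar>(x - y) \<bullet> b\<bar> \<and> \<bar>(x - y) \<bullet> b\<bar> \<le> 3/2" if "K y x \<noteq> 0" "b \<in> Basis" for x y b
      using supp[OF that] by (simp add: inner_diff_left abs_minus_commute)
  qed (use M in auto)
  ultimately show ?thesis
    unfolding hormander_operator_def K_def
    using linear_on_L2_conv_op bounded_on_L2_conv_op represented_by_conv_op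
      locally_integrable_off_diagonal_conv by fastforce
qed

section \<open>Failure of the weighted weak-type estimate\<close>

text \<open>For \<open>y\<close> in the ball around \<open>- One\<close>, the point
  \<open>x - y\<close> is within \<open>2 * \<delta> \<le> 1/2\<close> of \<open>One\<close>. It
  thus lies inside the cutoff, where the kernel is at least \<open>(2 * \<delta>) powr (- a)\<close>
  except at the singularity.\<close>

lemma norm_conv_shifted_power_indicator_ge:
  fixes x :: "'a::euclidean_space" and a \<delta> :: real
  assumes a: "0 \<le> a" "a < DIM('a)" and \<delta>: "0 < \<delta>" "\<delta> \<le> 1 / 4" and x: "norm x < \<delta>"
  shows "(2 * \<delta>) powr (- a) * (\<delta> ^ DIM('a) * measure lborel (ball (0::'a) 1))
    \<le> norm (conv_op (shifted_power a) (indicator (ball (- One) \<delta>)) x)"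
proof -
  obtain G where "integrable_kernel (shifted_power a :: 'a \<Rightarrow> real) G"
    by (rule integrable_kernel_shifted_power[OF a])
  then interpret integrable_kernel "shifted_power a :: 'a \<Rightarrow> real" G .
  define D where "D = ball (- One :: 'a) \<delta>"
  have D: "D \<in> sets borel" unfolding D_def by simp
  have eq: "(\<lambda>y. complex_of_real (shifted_power a (x - y)) * indicator D y)
      = (\<lambda>y. complex_of_real (shifted_power a (x - y) * indicator D y))"
    by (auto split: split_indicator)
  have int: "has_bochner_integral lborel
      (\<lambda>y. complex_of_real (shifted_power a (x - y) * indicator D y)) (conv_op (shifted_power a) (indicator D) x)"
    unfolding eq[symmetric]
    using D by (intro has_bochner_integral_conv_op[where M = 1] borel_measurable_indicator)
      (auto split: split_indicator)
  then have intr: "integrable lborel (\<lambda>y. shifted_power a (x - y) * indicator D y)"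
    unfolding complex_of_real_integrable_eq[symmetric] by (simp add: has_bochner_integral_iff)
  have emD: "emeasure lborel D = ennreal (\<delta> ^ DIM('a) * measure lborel (ball (0::'a) 1))"
    unfolding D_def using \<delta> by (intro emeasure_lborel_ball) auto
  have "(2 * \<delta>) powr (- a) * (\<delta> ^ DIM('a) * measure lborel (ball (0::'a) 1))
      = (LINT y|lborel. (2 * \<delta>) powr (- a) * indicator D y)"
    using emD \<delta> D by (simp add: measure_def)
  also have "\<dots> \<le> (LINT y|lborel. shifted_power a (x - y) * indicator D y)"
  proof (rule integral_mono_AE)
    show "integrable lborel (\<lambda>y. (2 * \<delta>) powr (- a) * indicator D y)"
      using D emD by (intro integrable_mult_right integrable_real_indicator) auto
    show "AE y in lborel. (2 * \<delta>) powr (- a) * indicator D y \<le> shifted_power a (x - y) * indicator D y"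
      \<comment> \<open>The excluded \<open>y\<close> puts \<open>x - y\<close> at the singularity,
        where the kernel has the value 0 and the lower bound fails.\<close>
      using AE_lborel_singleton[of "x - One"]
    proof eventually_elim
      case (elim y)
      show ?case
      proof (cases "y \<in> D")
        case True
        have "norm (x - y - One) \<le> norm x + norm (- One - y)"
          using norm_triangle_ineq[of x "- One - y"] by (simp add: algebra_simps)
        then have "norm (x - y - One) < 2 * \<delta>"
          using True x by (simp add: D_def dist_norm)
        moreover have "0 < norm (x - y - One)" using elim by (auto simp: algebra_simps)
        ultimately show ?thesis
          using True a \<delta> by (simp add: shifted_power_def powr_mono2')
      qed simp
    qed
  qed (rule intr)
  also have "\<dots> \<le> norm (complex_of_real (LINT y|lborel. shifted_power a (x - y) * indicator D y))"
    by simp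
  also have "complex_of_real (LINT y|lborel. shifted_power a (x - y) * indicator D y)
      = conv_op (shifted_power a) (indicator D) x"
    unfolding has_bochner_integral_integral_eq[OF int, symmetric] by (rule integral_complex_of_real[symmetric])
  finally show ?thesis unfolding D_def .
qed

lemma weak_type_norm_shifted_power:
  fixes a p \<gamma> :: real
  assumes a: "0 \<le> a" "a < DIM('a::euclidean_space)" and p: "1 \<le> p" and \<gamma>: "0 \<le> \<gamma>"
    and crit: "DIM('a) < a + \<gamma> * DIM('a) / p"
  shows "weak_type_norm (conv_op (shifted_power a :: 'a \<Rightarrow> real)) p
    (\<lambda>x. norm x powr (- \<gamma> * DIM('a))) = \<infinity>"
proof -
  define n where "n = real DIM('a)"
  define w where "w = (\<lambda>x::'a. norm x powr (- \<gamma> * n))"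
  define V where "V = measure lborel (ball (0::'a) 1)"
  \<comment> \<open>\<open>W0\<close> and \<open>W1\<close> bound the weight from below and above
    near \<open>- One\<close>. The exponent is not positive, so the larger radius gives the lower
    bound.\<close>
  define W0 where "W0 = (norm (One::'a) + 1) powr (- \<gamma> * n)"
  define W1 where "W1 = (1/2 :: real) powr (- \<gamma> * n)"
  \<comment> \<open>The exponent \<open>- \<eta>\<close> collects \<open>n - a\<close> from the size
    of the image, \<open>(n - \<gamma> * n) / p\<close> from the weighted measure of the ball at 0,
    and \<open>- n / p\<close> from the norm of \<open>f\<close>.\<close>
  define \<eta> where "\<eta> = a + \<gamma> * n / p - n"
  define \<kappa> where "\<kappa> = 2 powr (- a) * V / 2 / W1 powr (1 / p)"
  have \<gamma>n: "- \<gamma> * n \<le> 0" using \<gamma> unfolding n_def by simp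
  have V: "V > 0" unfolding V_def using content_ball_pos[of 1 "0::'a"] by simp
  have "norm (One::'a) + 1 > 0" by (intro add_nonneg_pos) auto
  then have W: "W0 > 0" "W1 > 0" unfolding W0_def W1_def by simp_all
  have \<eta>: "\<eta> > 0" using crit unfolding \<eta>_def n_def by simp
  have \<kappa>: "\<kappa> > 0" unfolding \<kappa>_def using V W by simp
  let ?T = "conv_op (shifted_power a :: 'a \<Rightarrow> real)"
  have lower: "ennreal (\<kappa> * \<delta> powr (- \<eta>)) \<le> weak_type_norm ?T p w" if \<delta>: "0 < \<delta>" "\<delta> \<le> 1/4" for \<delta>
  proof -
    define D where "D = ball (- One :: 'a) \<delta>"
    define f where "f = (indicator D :: 'a \<Rightarrow> complex)"
    have D: "D \<in> sets borel" unfolding D_def by simp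
    have \<delta>n: "\<delta> ^ DIM('a) = \<delta> powr n" using \<delta> unfolding n_def by (simp add: powr_realpow)
    have emD: "emeasure lborel D = ennreal (\<delta> powr n * V)"
      unfolding D_def V_def \<delta>n[symmetric] using \<delta> by (intro emeasure_lborel_ball) auto
    have f_meas: "f \<in> borel_measurable lborel" unfolding f_def using D by simp
    have f_L2: "f \<in> L2_space"
    proof -
      have "(\<integral>\<^sup>+x. (ennreal (norm (f x)))\<^sup>2 \<partial>lborel) = (\<integral>\<^sup>+x. indicator D x \<partial>lborel)"
        by (intro nn_integral_cong) (auto simp: f_def split: split_indicator)
      also have "\<dots> < \<infinity>" using D emD by simp
      finally show ?thesis
        using f_meas unfolding Lp_space_def Lp_norm_2 by (simp add: ennreal_powr_less_top)
    qed
    \<comment> \<open>The upper bound on \<open>i\<close> enters the quotient of norms; the lower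
      bound shows that \<open>f\<close> has nonzero norm and is admissible in the supremum.\<close>
    obtain i where i: "W0 * (\<delta> powr n * V) \<le> i" "i \<le> W1 * (\<delta> powr n * V)"
      "(\<integral>\<^sup>+x. ennreal (norm (f x) powr p * w x) \<partial>lborel) = ennreal i"
    proof -
      let ?I = "\<integral>\<^sup>+x. ennreal (norm (f x) powr p * w x) \<partial>lborel"
      have cmp: "norm y \<ge> 1/2 \<and> 0 < norm y \<and> norm y \<le> norm (One::'a) + 1" if "y \<in> D" for y
      proof -
        have "norm (y + One) < \<delta>"
          using that unfolding D_def mem_ball dist_norm by (simp add: norm_minus_commute)
        moreover have "norm (One::'a) \<ge> 1"
        proof -
          obtain b :: 'a where "b \<in> Basis" using nonempty_Basis by blast
          then show ?thesis using Basis_le_norm[of b One] by simp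
        qed
        moreover have "norm (One::'a) \<le> norm (y + One) + norm y"
          using norm_triangle_ineq4[of "y + One" y] by simp
        moreover have "norm y \<le> norm (y + One) + norm (One::'a)"
          using norm_triangle_ineq4[of "y + One" "One::'a"] by simp
        ultimately have "1/2 \<le> norm y" "0 < norm y" "norm y \<le> norm (One::'a) + 1"
          using \<delta> by linarith+
        then show ?thesis by blast
      qed
      have up: "?I \<le> (\<integral>\<^sup>+x. ennreal W1 * indicator D x \<partial>lborel)"
      proof (intro nn_integral_mono)
        fix x
        show "ennreal (norm (f x) powr p * w x) \<le> ennreal W1 * indicator D x"
        proof (cases "x \<in> D")
          case True
          then show ?thesis using cmp[of x] \<gamma>n unfolding f_def w_def W1_def
            by (auto intro!: ennreal_leI powr_mono2')
        qed (simp add: f_def)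
      qed
      have lo: "(\<integral>\<^sup>+x. ennreal W0 * indicator D x \<partial>lborel) \<le> ?I"
      proof (intro nn_integral_mono)
        fix x
        show "ennreal W0 * indicator D x \<le> ennreal (norm (f x) powr p * w x)"
        proof (cases "x \<in> D")
          case True
          then show ?thesis using cmp[of x] \<gamma>n unfolding f_def w_def W0_def
            by (auto intro!: ennreal_leI powr_mono2')
        qed (simp add: f_def)
      qed
      have ev: "(\<integral>\<^sup>+x. ennreal W * indicator D x \<partial>lborel) = ennreal (W * (\<delta> powr n * V))" if "0 < W" for W
        using that D emD V by (simp add: nn_integral_cmult_indicator ennreal_mult)
      from up have "?I \<le> ennreal (W1 * (\<delta> powr n * V))" unfolding ev[OF W(2)] .
      then obtain i where "0 \<le> i" "?I = ennreal i" by (cases ?I) (auto simp: top_unique)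
      moreover from this have "W0 * (\<delta> powr n * V) \<le> i" "i \<le> W1 * (\<delta> powr n * V)"
        using up lo mult_nonneg_nonneg[of W1 "\<delta> powr n * V"]
        unfolding ev[OF W(1)] ev[OF W(2)] using V W by simp_all
      ultimately show ?thesis using that by blast
    qed
    have i_pos: "i > 0" using i(1) W V \<delta> by (smt (verit) mult_pos_pos powr_gt_zero)
    have Lp: "Lp_norm p w f = ennreal (i powr (1 / p))"
      unfolding Lp_norm_def i(3) using i_pos by (simp add: ennreal_powr_ennreal)
    \<comment> \<open>Half of the lower bound for the image, so that the strict inequality defining
      the superlevel set holds.\<close>
    define t where "t = (2 * \<delta>) powr (- a) * (\<delta> powr n * V) / 2"
    have t: "t > 0" unfolding t_def using \<delta> V by simp
    have "ennreal (\<delta> powr (- \<gamma> * n) * (\<delta> powr n * V)) \<le> weighted_measure w {x. norm (?T f x) > t}"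
    proof -
      have B: "ball (0::'a) \<delta> \<in> sets borel" by simp
      have "ennreal (\<delta> powr (- \<gamma> * n) * (\<delta> powr n * V))
          = (\<integral>\<^sup>+x. ennreal (\<delta> powr (- \<gamma> * n)) * indicator (ball (0::'a) \<delta>) x \<partial>lborel)"
        using \<delta> V B by (simp add: nn_integral_cmult_indicator emeasure_lborel_ball \<delta>n V_def[symmetric] ennreal_mult)
      also have "\<dots> \<le> (\<integral>\<^sup>+x. ennreal (w x) * indicator {x. norm (?T f x) > t} x \<partial>lborel)"
      proof (rule nn_integral_mono_AE)
        show "AE x in lborel. ennreal (\<delta> powr (- \<gamma> * n)) * indicator (ball (0::'a) \<delta>) x
            \<le> ennreal (w x) * indicator {x. norm (?T f x) > t} x"
          \<comment> \<open>The origin is left out because \<open>w\<close> is 0 there by the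
            convention for \<open>powr\<close>.\<close>
          using AE_lborel_singleton[of "0::'a"]
        proof eventually_elim
          case (elim x)
          show ?case
          proof (cases "norm x < \<delta>")
            case True
            have "2 * t \<le> norm (?T f x)"
              using norm_conv_shifted_power_indicator_ge[OF a \<delta> True]
              unfolding t_def f_def D_def V_def \<delta>n by simp
            then have "t < norm (?T f x)" using t by linarith
            moreover have "\<delta> powr (- \<gamma> * n) \<le> w x"
              unfolding w_def using True elim \<gamma>n by (intro powr_mono2') auto
            ultimately show ?thesis using True by (auto intro: ennreal_leI)
          qed simp
        qed
      qed
      finally show ?thesis unfolding weighted_measure_def .
    qed
    then have "ennreal_powr (ennreal (\<delta> powr (- \<gamma> * n) * (\<delta> powr n * V))) (1 / p)
        \<le> ennreal_powr (weighted_measure w {x. norm (?T f x) > t}) (1 / p)"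
      using p by (intro ennreal_powr_mono) auto
    then have "ennreal t * ennreal ((\<delta> powr (- \<gamma> * n) * (\<delta> powr n * V)) powr (1 / p))
        \<le> ennreal t * ennreal_powr (weighted_measure w {x. norm (?T f x) > t}) (1 / p)"
      using V by (intro mult_left_mono) (simp_all add: ennreal_powr_ennreal)
    also have "\<dots> \<le> weak_Lp_norm p w (?T f)"
      unfolding weak_Lp_norm_def using t by (intro SUP_upper) auto
    finally have weak: "ennreal (t * (\<delta> powr (- \<gamma> * n) * (\<delta> powr n * V)) powr (1 / p)) \<le> weak_Lp_norm p w (?T f)"
      using t by (simp add: ennreal_mult)
    have "\<kappa> * \<delta> powr (- \<eta>)
        = t * (\<delta> powr (- \<gamma> * n) * (\<delta> powr n * V)) powr (1 / p) / (W1 * (\<delta> powr n * V)) powr (1 / p)"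
    proof -
      have e: "\<delta> powr (- \<eta>) = \<delta> powr (- a) * \<delta> powr n * (\<delta> powr (- \<gamma> * n)) powr (1 / p)"
        unfolding \<eta>_def powr_powr powr_add[symmetric] by (simp add: algebra_simps)
      have "(\<delta> powr n * V) powr (1 / p) > 0" using V \<delta> by simp
      then show ?thesis
        unfolding \<kappa>_def t_def e powr_mult by (simp add: field_simps)
    qed
    also have "\<dots> \<le> t * (\<delta> powr (- \<gamma> * n) * (\<delta> powr n * V)) powr (1 / p) / i powr (1 / p)"
      using i i_pos p t W V \<delta> by (intro divide_left_mono powr_mono2 mult_nonneg_nonneg mult_pos_pos) auto
    finally have "ennreal (\<kappa> * \<delta> powr (- \<eta>))
        \<le> ennreal (t * (\<delta> powr (- \<gamma> * n) * (\<delta> powr n * V)) powr (1 / p)) / ennreal (i powr (1 / p))"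
      using i_pos t by (subst divide_ennreal) (auto intro: ennreal_leI)
    also have "\<dots> \<le> weak_Lp_norm p w (?T f) / Lp_norm p w f"
      unfolding Lp by (intro divide_right_mono_ennreal weak)
    also have "\<dots> \<le> weak_type_norm ?T p w"
      unfolding weak_type_norm_def
    proof (intro SUP_upper)
      show "f \<in> {f \<in> L2_space \<inter> Lp_space p w. Lp_norm p w f \<noteq> 0}"
        using f_L2 f_meas Lp i_pos unfolding Lp_space_def by simp
    qed
    finally show ?thesis .
  qed
  have "weak_type_norm ?T p w = \<infinity>"
  proof (rule ccontr)
    assume "weak_type_norm ?T p w \<noteq> \<infinity>"
    then obtain B where B: "0 \<le> B" "weak_type_norm ?T p w = ennreal B"
      by (cases "weak_type_norm ?T p w") auto
    \<comment> \<open>The second entry solves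
      \<open>\<kappa> * \<delta> powr (- \<eta>) = B + 1\<close>; a smaller \<open>\<delta>\<close>
      only increases the left side.\<close>
    define \<delta> where "\<delta> = min (1/4) ((\<kappa> / (B + 1)) powr (1 / \<eta>))"
    have \<delta>: "0 < \<delta>" "\<delta> \<le> 1/4" unfolding \<delta>_def using \<kappa> B by auto
    have "((\<kappa> / (B + 1)) powr (1 / \<eta>)) powr (- \<eta>) \<le> \<delta> powr (- \<eta>)"
      using \<delta> \<eta> by (intro powr_mono2') (auto simp: \<delta>_def)
    moreover have "((\<kappa> / (B + 1)) powr (1 / \<eta>)) powr (- \<eta>) = (B + 1) / \<kappa>"
      using \<eta> \<kappa> B by (simp add: powr_powr powr_minus)
    ultimately have "B + 1 \<le> \<kappa> * \<delta> powr (- \<eta>)" using \<kappa> by (simp add: field_simps)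
    then have "ennreal (B + 1) \<le> ennreal B"
      using lower[OF \<delta>] B ennreal_leI order_trans by metis
    then show False using B by simp
  qed
  then show ?thesis unfolding w_def n_def by simp
qed

section \<open>Choice of the exponents\<close>

text \<open>In real terms \<open>1 / r'\<close> is \<open>1 - 1 / r\<close>, also for infinite
  \<open>r'\<close>, where both are 0 and \<open>r = 1\<close>. Positivity of
  \<open>\<gamma>\<close> follows as \<open>p / r'\<close> is nonnegative.\<close>

lemma conjugate_exponent_bounds:
  fixes r p \<gamma> :: real and r' :: ereal
  assumes "1 \<le> r" and "1 / ereal r + 1 / r' = 1" and "1 \<le> p" and "ereal p < r'"
    and "ereal p / r' < ereal \<gamma>"
  shows "p * (1 - 1 / r) < \<gamma> \<and> 0 < \<gamma>"
proof (cases r')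
  case (real \<rho>)
  then have \<rho>: "p < \<rho>" using assms(4) by simp
  then have "0 < \<rho>" using assms(3) by linarith
  have "1 / r + 1 / \<rho> = 1"
  proof -
    have "1 / ereal r + 1 / r' = ereal (1 / r + 1 / \<rho>)"
      using assms(1) \<open>0 < \<rho>\<close> by (simp add: real one_ereal_def del: ereal_eq_1)
    with assms(2) show ?thesis by simp
  qed
  then have "1 - 1 / r = 1 / \<rho>" by linarith
  moreover have "p / \<rho> < \<gamma>" using assms(5) \<open>0 < \<rho>\<close> by (simp add: real)
  moreover have "0 < p / \<rho>" using \<open>0 < \<rho>\<close> assms(3) by simp
  ultimately show ?thesis by simp
next
  case PInf
  have "1 / ereal r + 1 / r' = ereal (1 / r)"
    using assms(1) by (simp add: PInf one_ereal_def del: ereal_eq_1)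
  then have "1 / r = 1" using assms(2) by simp
  moreover have "0 < \<gamma>" using assms(5) by (simp add: PInf)
  ultimately show ?thesis by simp
next
  case MInf
  then show ?thesis using assms(4) by simp
qed

theorem theorem2p4:
  fixes r p \<gamma> c\<^sub>A :: real and r' :: ereal and A \<phi> :: "real \<Rightarrow> real"
  assumes "1 \<le> r" and "1 / ereal r + 1 / r' = 1"
    and "1 \<le> p" and "ereal p < r'"
    and "ereal p / r' < ereal \<gamma>" and "\<gamma> < 1"
    and "young_function A"
    and "c\<^sub>A > 0"
    and "comparable_on {c\<^sub>A<..} (young_inverse A) (\<lambda>t. t powr (1 / r) / \<phi> t)"
    and "\<forall>t>0. \<phi> t > 0"
    and "\<forall>s\<in>{0<..<1}. \<exists>c>0. \<exists>\<kappa>>0. \<forall>t>c. 0 < \<phi> t \<and> \<phi> t < \<kappa> * t powr s"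
  shows "\<exists>T :: (real ^ 'n \<Rightarrow> complex) \<Rightarrow> (real ^ 'n \<Rightarrow> complex).
           hormander_operator A T \<and>
           weak_type_norm T p (\<lambda>x. norm x powr (- \<gamma> * real CARD('n))) = \<infinity>"
proof -
  have \<gamma>: "p * (1 - 1 / r) < \<gamma>" "0 < \<gamma>"
    using conjugate_exponent_bounds[OF assms(1-5)] by auto
  define R where "R = 1 / r"
  \<comment> \<open>A rearrangement of \<open>p * (1 - 1 / r) < \<gamma>\<close>; it opens the
    interval from which \<open>\<theta>\<close> is taken.\<close>
  have "1 - \<gamma> / p < R" using \<gamma>(1) assms(3) unfolding R_def[symmetric] by (simp add: field_simps)
  then obtain \<theta> where \<theta>: "1 - \<gamma> / p < \<theta>" "\<theta> < R" using dense by blast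
  have "\<gamma> / p < 1" using assms(3,6) by simp
  then have \<theta>0: "0 < \<theta>" using \<theta> by linarith
  have R1: "R \<le> 1" unfolding R_def using assms(1) by simp
  \<comment> \<open>With this \<open>s\<close>, the number \<open>R - s\<close> is the midpoint of
    \<open>\<theta>\<close> and \<open>R\<close>; it exceeds \<open>\<theta>\<close>, which is
    \<open>\<theta> * q < 1\<close>.\<close>
  define s where "s = (R - \<theta>) / 2"
  define q where "q = 1 / (R - s)"
  have s: "0 < s" "s < R" "s < 1"
    unfolding s_def using \<theta> \<theta>0 R1 by auto
  have "R - s = (R + \<theta>) / 2" unfolding s_def by (simp add: field_simps)
  then have Rs: "0 < R - s" "\<theta> < R - s" using \<theta> \<theta>0 by auto
  have \<phi>: "\<exists>c>0. \<exists>\<kappa>>0. \<forall>t>c. 0 < \<phi> t \<and> \<phi> t < \<kappa> * t powr s"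
    by (rule bspec[OF assms(11)]) (simp add: s)
  obtain C where C: "0 < C" "\<And>t. 0 \<le> t \<Longrightarrow> A t \<le> C * (1 + t powr q)"
    by (rule young_function_power_bound[OF assms(7,1) s(1,2)[unfolded R_def] assms(8,9) \<phi>,
          folded R_def, folded q_def]) (rule that)
  have q: "0 < q" "\<theta> * q < 1" unfolding q_def using Rs by simp_all
  define n where "n = real CARD('n)"
  have n: "n > 0" "n = real DIM(real ^ 'n)" unfolding n_def by auto
  define a where "a = n * \<theta>"
  \<comment> \<open>In order after nonnegativity: integrability of the kernel, finiteness of its
    \<open>q\<close>-th power integral, and blow-up of the test quotient.\<close>
  have a: "0 \<le> a" "a < n" "a * q < n" "n < a + \<gamma> * n / p"
  proof -
    show "0 \<le> a" unfolding a_def using n \<theta>0 by simp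
    show "a < n" unfolding a_def using n \<theta> R1 by simp
    show "a * q < n" unfolding a_def using mult_strict_left_mono[OF q(2) n(1)] by (simp add: mult.assoc)
    have "n * 1 < n * (\<theta> + \<gamma> / p)" using n(1) \<theta>(1) by (intro mult_strict_left_mono) auto
    then show "n < a + \<gamma> * n / p" unfolding a_def by (simp add: algebra_simps)
  qed
  have "hormander_operator A (conv_op (shifted_power a :: real ^ 'n \<Rightarrow> real))"
    by (rule hormander_operator_shifted_power[OF assms(7) C a(1) a(2)[unfolded n(2)] q(1) a(3)[unfolded n(2)]])
  moreover have "weak_type_norm (conv_op (shifted_power a :: real ^ 'n \<Rightarrow> real)) p
      (\<lambda>x. norm x powr (- \<gamma> * real DIM(real ^ 'n))) = \<infinity>"
    by (rule weak_type_norm_shifted_power[OF a(1) a(2)[unfolded n(2)] assms(3) less_imp_le[OF \<gamma>(2)]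
          a(4)[unfolded n(2)]])
  then have "weak_type_norm (conv_op (shifted_power a :: real ^ 'n \<Rightarrow> real)) p
      (\<lambda>x. norm x powr (- \<gamma> * real CARD('n))) = \<infinity>"
    unfolding n(2)[symmetric] n_def .
  ultimately show ?thesis by blast
qed

end
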